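(* Let $n\ge1$ and $t>r\ge1$ be integers, and let $S_{2,n}$ be the slant grid graph with $2$ rows and $n$ columns. Then \[\gamma_{t,r}(S_{2,n})=\left\lceil \frac{2(n+r-1)}{4t-2r-1}\right\rceil .\]
   Context: The slant grid graph $S_{m,n}$ with $m$ rows and $n$ columns has vertices $(i,j)$ with integers $0\le i\le n-1$ (column, left to right) and $0\le j\le m-1$ (row, bottom to top), and edges joining $(i,j)$ to $(i+1,j)$, to $(i,j+1)$, and to $(i+1,j+1)$ whenever both endpoints are vertices. For a connected graph $G$ with vertex set $V(G)$ and graph distance $d$, positive integers $t,r$, and a set $\mathbb T\subseteq V(G)$ (whose elements are called towers, of strength $t$), the signal received by $v\in V(G)$ is $f(v)=\sum_{w\in\mathbb T}\max\{0,\,t-d(v,w)\}$ (a tower also receives its own signal). The set $\mathbb T$ is a $(t,r)$ broadcast dominating set if $f(v)\ge r$ for every $v\in V(G)$. The $(t,r)$ broadcast domination number $\gamma_{t,r}(G)$ is the minimum cardinality of a $(t,r)$ broadcast dominating set of $G$. *)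

theory Defs
  imports Complex_Main
begin

text \<open>
  A graph is given by its vertex set \<open>V\<close> and its adjacency relation \<open>E\<close>,
  a symmetric relation on \<open>V\<close>.
\<close>

text \<open>
  The length of a shortest walk; the value is unspecified if \<open>u\<close> and \<open>v\<close> lie in
  different components, so this is to be used for connected graphs only.
\<close>

definition graph_dist :: "'a rel \<Rightarrow> 'a \<Rightarrow> 'a \<Rightarrow> nat" where
  "graph_dist E u v = (LEAST k. (u, v) \<in> E ^^ k)"

definition signal :: "'a rel \<Rightarrow> nat \<Rightarrow> 'a set \<Rightarrow> 'a \<Rightarrow> int" where
  "signal E t T v = (\<Sum>w\<in>T. max 0 (int t - int (graph_dist E v w)))"

definition broadcast_dominating ::
  "'a set \<Rightarrow> 'a rel \<Rightarrow> nat \<Rightarrow> nat \<Rightarrow> 'a set \<Rightarrow> bool" where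
  "broadcast_dominating V E t r T \<longleftrightarrow> T \<subseteq> V \<and> (\<forall>v\<in>V. int r \<le> signal E t T v)"

text \<open>
  The minimum is meaningful for finite \<open>V\<close> with at least one dominating set;
  for \<open>r \<le> t\<close> the set \<open>V\<close> itself is one.
\<close>

definition broadcast_domination_number ::
  "'a set \<Rightarrow> 'a rel \<Rightarrow> nat \<Rightarrow> nat \<Rightarrow> nat" where
  "broadcast_domination_number V E t r =
     (LEAST k. \<exists>T. broadcast_dominating V E t r T \<and> card T = k)"

text \<open>Vertices are pairs (column, row); \<open>m\<close> is the number of rows, \<open>n\<close> of columns.\<close>

definition slant_grid_verts :: "nat \<Rightarrow> nat \<Rightarrow> (nat \<times> nat) set" where
  "slant_grid_verts m n = {0..<n} \<times> {0..<m}"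

definition slant_grid_arcs :: "nat \<Rightarrow> nat \<Rightarrow> (nat \<times> nat) rel" where
  "slant_grid_arcs m n =
     {((i, j), (i', j')). (i, j) \<in> slant_grid_verts m n \<and> (i', j') \<in> slant_grid_verts m n \<and>
        (i', j') \<in> {(i + 1, j), (i, j + 1), (i + 1, j + 1)}}"

definition slant_grid_adj :: "nat \<Rightarrow> nat \<Rightarrow> (nat \<times> nat) rel" where
  "slant_grid_adj m n = slant_grid_arcs m n \<union> (slant_grid_arcs m n)\<inverse>"

end

theory Submission
  imports Defs
begin

text \<open>
  Reading the strip in zigzag order, \<open>(i, j)\<close> at position \<open>2 i + 1 - j\<close>, identifies \<open>S\<^bsub>2,n\<^esub>\<close>
  with the square of the path on \<open>2 n\<close> vertices, where \<open>d(x, y) = \<lceil>\<bar>x - y\<bar> / 2\<rceil>\<close>.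
  Two towers at distance \<open>p = 4 t - 2 r - 1\<close> supply \<open>r\<close> to everything between them, and a tower
  supplies \<open>r\<close> up to distance \<open>2 (t - r)\<close>, so equally spaced towers, the last one
  moved back to the end of the path if necessary, give the upper bound.

  For the lower bound, add a virtual tower on either side whose signal just fails to reach the path;
  the claim becomes that the mean gap between consecutive towers is at most \<open>p\<close>. Let \<open>h\<close> be the
  excess of a gap over \<open>p\<close>. If \<open>h > 0\<close>, the first position not reached by the towers left of
  the gap needs at least two towers from the right, which forces the next gap to be so short that
  its excess is at most \<open>- h\<close>; symmetrically for the previous gap. Pairing each long gap with
  its successor leaves over only the last gap, which is paired with its predecessor; if
  that one is already used, the last three gaps together have nonpositive excess.
\<close>

section \<open>Signals on the square of a path\<close>

definition path_signal :: "int \<Rightarrow> int \<Rightarrow> int" where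
  "path_signal t d = max 0 (t - (\<bar>d\<bar> + 1) div 2)"

lemma path_signal_nonneg: "0 \<le> path_signal t d"
  by (simp add: path_signal_def)

lemma path_signal_ge: "t - (\<bar>d\<bar> + 1) div 2 \<le> path_signal t d"
  by (simp add: path_signal_def)

text \<open>Offset \<open>2 * t - 1\<close> rounds up to graph distance \<open>t\<close>. The
  virtual towers are placed exactly this far from the end positions.\<close>

lemma path_signal_eq_0: "2 * t - 1 \<le> \<bar>d\<bar> \<Longrightarrow> path_signal t d = 0"
  by (auto simp: path_signal_def max_def)

section \<open>Lower bound: gaps between consecutive towers\<close>

lemma dominating_path_square_lower:
  fixes w :: "nat \<Rightarrow> int" and t r N :: int
  assumes r: "1 \<le> r" "r < t" and N: "1 \<le> N"
    and w_less: "\<And>i j. 1 \<le> i \<Longrightarrow> i < j \<Longrightarrow> j \<le> k \<Longrightarrow> w i < w j"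
    and w_range: "\<And>i. 1 \<le> i \<Longrightarrow> i \<le> k \<Longrightarrow> 0 \<le> w i \<and> w i < N"
    and dom: "\<And>x. 0 \<le> x \<Longrightarrow> x < N \<Longrightarrow> r \<le> (\<Sum>i=1..k. path_signal t (x - w i))"
  shows "N + 2 * r - 2 \<le> int k * (4 * t - 2 * r - 1)"
proof -
  define p where "p = 4 * t - 2 * r - 1"
  \<comment> \<open>positions with the virtual towers \<open>0\<close> and \<open>k + 1\<close> added\<close>
  define v where "v i = (if i = 0 then - (2 * t - 1) else if i \<le> k then w i else N + 2 * t - 2)" for i
  define h where "h i = v (Suc i) - v i - p" for i
  have v_0: "v 0 = - (2 * t - 1)" and v_last: "v (Suc k) = N + 2 * t - 2"
    by (simp_all add: v_def)
  have v_less: "v i < v j" if "i < j" "j \<le> Suc k" for i j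
    using that w_less[of i j] w_range[of i] w_range[of j] r N by (auto simp: v_def)
  have v_le: "v i \<le> v j" if "i \<le> j" "j \<le> Suc k" for i j
    using v_less[of i j] that by (cases "i = j") auto
  have v_range: "0 \<le> v i \<and> v i < N" if "1 \<le> i" "i \<le> k" for i
    using w_range[OF that] that by (simp add: v_def)
  \<comment> \<open>Only the real towers \<open>1..k\<close> emit, and those out of reach of
    \<open>x\<close> may be dropped.\<close>
  have dom_on: "r \<le> (\<Sum>i\<in>A. path_signal t (x - v i))"
    if "0 \<le> x" "x < N" "A \<subseteq> {1..k}" and "\<And>i. i \<in> {1..k} - A \<Longrightarrow> path_signal t (x - v i) = 0" for x A
  proof -
    have "(\<Sum>i\<in>A. path_signal t (x - v i)) = (\<Sum>i=1..k. path_signal t (x - v i))"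
      using that by (intro sum.mono_neutral_left) auto
    also have "\<dots> = (\<Sum>i=1..k. path_signal t (x - w i))"
      by (rule sum.cong) (auto simp: v_def)
    finally show ?thesis using dom[OF that(1,2)] by simp
  qed
  have k: "1 \<le> k"
    using dom_on[of 0 "{}"] N r by (cases "k = 0") auto

  \<comment> \<open>This is the first position beyond the reach of tower \<open>j\<close>. As
    \<open>p > 2 * t - 1\<close>, it lies before tower \<open>j + 1\<close>, hence inside the
    path.\<close>
  have wide_point: "0 \<le> v j + 2 * t - 1" "v j + 2 * t - 1 < N"
    if "j < k" "0 < h j" for j
    using v_range[of j] v_range[of "Suc j"] that r v_0
    by (cases "j = 0"; auto simp: h_def p_def; linarith)+

  \<comment> \<open>At that position tower \<open>j + 1\<close> supplies less than \<open>r\<close>,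
    so a later real tower must be within reach, and \<open>j + 2\<close> is the nearest
    candidate.\<close>
  have wide_right: "h j + (v (j + 2) - v (j + 1)) \<le> 2 * r - 2" if j: "j < k" "0 < h j" for j
  proof (rule ccontr)
    assume *: "\<not> ?thesis"
    let ?x = "v j + 2 * t - 1"
    have "r \<le> (\<Sum>i\<in>{Suc j}. path_signal t (?x - v i))"
    proof (rule dom_on)
      fix i assume i: "i \<in> {1..k} - {Suc j}"
      show "path_signal t (?x - v i) = 0"
      proof (cases "i \<le> j")
        case True
        then show ?thesis using v_le[of i j] j by (intro path_signal_eq_0) auto
      next
        case False
        with i have "v (j + 2) \<le> v i" by (intro v_le) auto
        then show ?thesis using * by (intro path_signal_eq_0) (auto simp: h_def p_def)
      qed
    qed (use wide_point[OF j] j in auto)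
    moreover have "?x - v (Suc j) = - (2 * t - 2 * r + h j)" by (simp add: h_def p_def)
    ultimately show False using j r by (auto simp: path_signal_def)
  qed

  \<comment> \<open>The mirror image, at position \<open>N - 1\<close>: tower \<open>k\<close> alone
    is too weak there, so an earlier one must reach it.\<close>
  have wide_last: "h k + (v k - v (k - 1)) \<le> 2 * r - 2" if h: "0 < h k"
  proof (rule ccontr)
    assume *: "\<not> ?thesis"
    have "r \<le> (\<Sum>i\<in>{k}. path_signal t (N - 1 - v i))"
    proof (rule dom_on)
      fix i assume i: "i \<in> {1..k} - {k}"
      then have "v i \<le> v (k - 1)" by (intro v_le) auto
      then show "path_signal t (N - 1 - v i) = 0"
        using * v_last by (intro path_signal_eq_0) (auto simp: h_def p_def)
    qed (use k N in auto)
    moreover have "N - 1 - v k = 2 * t - 2 * r + h k" using v_last by (simp add: h_def p_def)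
    ultimately show False using h r by (auto simp: path_signal_def)
  qed

  \<comment> \<open>The left side telescopes to \<open>h 0 + ... + h m\<close>. A positive
    \<open>h m\<close> is cancelled by \<open>h (Suc m)\<close>, so only a long final gap can stay
    unpaired.\<close>
  have prefix: "v (Suc m) - v 0 - int (Suc m) * p \<le> max 0 (h m)" if "m \<le> k" for m
    using that
  proof (induction m)
    case 0
    then show ?case by (simp add: h_def)
  next
    case (Suc m)
    have step: "v (Suc (Suc m)) - v 0 - int (Suc (Suc m)) * p
        = (v (Suc m) - v 0 - int (Suc m) * p) + h (Suc m)"
      by (simp add: h_def algebra_simps)
    show ?case
    proof (cases "0 < h m")
      case True
      with wide_right[of m] Suc.prems r have "h m + h (Suc m) \<le> 0"
        by (simp add: h_def p_def)
      with True Suc step show ?thesis by simp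
    qed (use Suc step in simp)
  qed

  \<comment> \<open>The left side is \<open>N + 4 * t - 3 - (k + 1) * p\<close>, so this is the
    claim after moving one \<open>p\<close> across.\<close>
  have "v (Suc k) - v 0 - int (Suc k) * p \<le> 0"
  proof (cases "0 < h k")
    case False
    with prefix[of k] show ?thesis by simp
  next
    case hk: True
    obtain m where m: "k = Suc m" using k by (cases k) auto
    have hm: "h m + h k \<le> 0"
      using wide_last[OF hk] r m by (simp add: h_def p_def)
    show ?thesis
    proof (cases m)
      case 0
      with hm m show ?thesis by (simp add: h_def)
    next
      case (Suc l)
      have expand: "v (Suc k) - v 0 - int (Suc k) * p = (v (Suc l) - v 0 - int (Suc l) * p) + h m + h k"
        using m Suc by (simp add: h_def algebra_simps)
      show ?thesis
      proof (cases "0 < h l")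
        case False
        with prefix[of l] expand hm m Suc show ?thesis by simp
      next
        case hl: True
        define d where "d = v k - v m"
        have d: "h m = d - p" "0 < d" using m v_less[of m k] by (auto simp: h_def d_def)
        have dl: "h l + d \<le> 2 * r - 2" using wide_right[of l] hl m Suc by (simp add: d_def)
        have dk: "h k + d \<le> 2 * r - 2" using wide_last[OF hk] m by (simp add: d_def)
        \<comment> \<open>Both outer gaps are long and compete for the middle gap \<open>d\<close>.
          At either test position only \<open>m\<close> and \<open>k\<close> are heard, and by
          \<open>dl\<close> and \<open>dk\<close> neither signal is truncated, so the two distances
          can be added.\<close>
        have "r \<le> (\<Sum>i\<in>{m, k}. path_signal t (v l + 2 * t - 1 - v i))"
        proof (rule dom_on)
          fix i assume "i \<in> {1..k} - {m, k}"
          then have "v i \<le> v l" using m Suc by (intro v_le) auto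
          then show "path_signal t (v l + 2 * t - 1 - v i) = 0" by (intro path_signal_eq_0) auto
        qed (use wide_point[of l] hl m Suc in auto)
        moreover have "v l + 2 * t - 1 - v m = - (2 * t - 2 * r + h l)"
            "v l + 2 * t - 1 - v k = - (2 * t - 2 * r + h l + d)"
          using Suc by (simp_all add: h_def p_def d_def)
        ultimately have el: "2 * h l + d \<le> 2 * r"
          using hl dl d m r by (auto simp: path_signal_def)
        have "r \<le> (\<Sum>i\<in>{m, k}. path_signal t (N - 1 - v i))"
        proof (rule dom_on)
          fix i assume "i \<in> {1..k} - {m, k}"
          then have "v i \<le> v l" using m Suc by (intro v_le) auto
          moreover have "N - 1 - v l = 2 * t - 2 * r + h k + d + p + h l"
            using v_last Suc by (simp add: h_def p_def d_def)
          ultimately show "path_signal t (N - 1 - v i) = 0"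
            using hl hk d r by (intro path_signal_eq_0) (auto simp: p_def)
        qed (use N m Suc in auto)
        moreover have "N - 1 - v k = 2 * t - 2 * r + h k"
            "N - 1 - v m = 2 * t - 2 * r + h k + d"
          using v_last by (simp_all add: h_def p_def d_def)
        ultimately have ek: "2 * h k + d \<le> 2 * r"
          using hk dk d m r by (auto simp: path_signal_def)
        \<comment> \<open>Averaging \<open>el\<close> and \<open>ek\<close> gives
          \<open>h l + h k + d \<le> 2 * r\<close>, and \<open>2 * r < p\<close>.\<close>
        have "h l + h m + h k \<le> 0" using el ek d r by (simp add: p_def)
        moreover have "v (Suc l) - v 0 - int (Suc l) * p \<le> h l"
          using prefix[of l] hl m Suc by simp
        ultimately show ?thesis using expand by linarith
      qed
    qed
  qed
  then show ?thesis using v_0 v_last by (simp add: p_def algebra_simps)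
qed

text \<open>Enumerates the towers increasingly from index 1, index 0 being kept for the left virtual
  tower.\<close>

lemma dominating_path_square_card:
  fixes T :: "int set" and t r N :: int
  assumes r: "1 \<le> r" "r < t" and N: "1 \<le> N" and T: "T \<subseteq> {0..<N}"
    and dom: "\<And>x. 0 \<le> x \<Longrightarrow> x < N \<Longrightarrow> r \<le> (\<Sum>y\<in>T. path_signal t (x - y))"
  shows "N + 2 * r - 2 \<le> int (card T) * (4 * t - 2 * r - 1)"
proof -
  have fin: "finite T" using T finite_subset by blast
  define l where "l = sorted_list_of_set T"
  define w where "w i = l ! (i - 1)" for i
  have len: "length l = card T" and dist: "distinct l" and set: "set l = T"
    using fin by (simp_all add: l_def)
  have bij: "bij_betw w {1..card T} T"
  proof -
    have "bij_betw (\<lambda>i. i - 1) {1..card T} {..<card T}"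
      by (rule bij_betw_byWitness[where f' = Suc]) auto
    moreover have "bij_betw ((!) l) {..<card T} T"
      using dist len set by (intro bij_betw_nth) auto
    ultimately have "bij_betw ((!) l \<circ> (\<lambda>i. i - 1)) {1..card T} T"
      by (rule bij_betw_trans)
    then show ?thesis by (simp add: w_def[abs_def] comp_def)
  qed
  show ?thesis
  proof (rule dominating_path_square_lower[OF r N, where w = w])
    fix i j :: nat assume "1 \<le> i" "i < j" "j \<le> card T"
    moreover have "sorted_wrt (<) l" by (simp add: l_def)
    ultimately show "w i < w j"
      using sorted_wrt_nth_less[of "(<)" l "i - 1" "j - 1"] len by (simp add: w_def)
  next
    fix i :: nat assume "1 \<le> i" "i \<le> card T"
    then have "w i \<in> T" using bij by (auto simp: bij_betw_def)
    then show "0 \<le> w i \<and> w i < N" using T by auto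
  next
    fix x assume "0 \<le> x" "x < N"
    then show "r \<le> (\<Sum>i=1..card T. path_signal t (x - w i))"
      using dom[of x] sum.reindex_bij_betw[OF bij, of "\<lambda>y. path_signal t (x - y)"] by simp
  qed
qed

section \<open>Upper bound: equally spaced towers\<close>

lemma dominating_path_square_exists:
  fixes t r N K p :: int
  assumes r: "1 \<le> r" "r < t" and N: "1 \<le> N" and p: "p = 4 * t - 2 * r - 1"
    and K: "1 \<le> K" "N + 2 * r - 2 \<le> K * p" "(K - 1) * p < N + 2 * r - 2"
  obtains T where "T \<subseteq> {0..<N}" "int (card T) \<le> K"
    "\<And>x. 0 \<le> x \<Longrightarrow> x < N \<Longrightarrow> r \<le> (\<Sum>y\<in>T. path_signal t (x - y))"
proof -
  \<comment> \<open>\<open>c 0\<close> is the farthest place from which a tower still supplies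
    \<open>r\<close> to position 0. Clipping in \<open>b\<close> affects at most the last
    tower.\<close>
  define c where "c j = 2 * (t - r) + j * p" for j
  define b where "b j = min (N - 1) (c j)" for j
  have ppos: "0 < p" using r p by simp
  show thesis
  proof (rule that)
    show "b ` {0..<K} \<subseteq> {0..<N}"
      using N r ppos by (auto simp: b_def c_def)
    have "card (b ` {0..<K}) \<le> card {0..<K}" by (rule card_image_le) simp
    then show "int (card (b ` {0..<K})) \<le> K" using K by simp
  next
    fix x assume x: "0 \<le> x" "x < N"
    let ?f = "\<lambda>y. path_signal t (x - y)"
    have one: "r \<le> sum ?f (b ` {0..<K})"
      if "0 \<le> j" "j < K" "\<bar>x - b j\<bar> \<le> 2 * (t - r)" for j
    proof -
      have "r \<le> ?f (b j)" using path_signal_ge[of t "x - b j"] that(3) by presburger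
      also have "\<dots> \<le> sum ?f (b ` {0..<K})"
        using that by (intro member_le_sum) (auto simp: path_signal_nonneg)
      finally show ?thesis .
    qed
    consider "x \<le> c 0" | "c (K - 1) \<le> x" | "c 0 < x" "x < c (K - 1)" by linarith
    then show "r \<le> sum ?f (b ` {0..<K})"
    proof cases
      case 1
      then show ?thesis using x K by (intro one[of 0]) (auto simp: b_def c_def)
    next
      case 2
      \<comment> \<open>\<open>K * p\<close> is large enough for the last tower to supply
        \<open>r\<close> up to position \<open>N - 1\<close>.\<close>
      have "K * p = (K - 1) * p + p" by (simp add: algebra_simps)
      then have "N - 1 - c (K - 1) \<le> 2 * (t - r)" using K p by (simp add: c_def)
      then show ?thesis using x K 2 by (intro one[of "K - 1"]) (auto simp: b_def)
    next
      case 3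
      define j where "j = (x - c 0) div p"
      have xj: "c j \<le> x" "x < c (j + 1)"
      proof -
        have "x - c 0 = j * p + (x - c 0) mod p" by (simp add: j_def)
        moreover have "0 \<le> (x - c 0) mod p" "(x - c 0) mod p < p" using ppos by auto
        ultimately show "c j \<le> x" "x < c (j + 1)" by (auto simp: c_def algebra_simps)
      qed
      have j0: "0 \<le> j" using 3 ppos by (simp add: j_def pos_imp_zdiv_nonneg_iff)
      have "j * p < (K - 1) * p" using xj(1) 3(2) by (simp add: c_def)
      then have jK: "j < K - 1" using ppos by (simp add: mult_less_cancel_right)
      have b_j: "b j = c j" using xj x by (simp add: b_def)
      have b_j': "x \<le> b (j + 1)" "b (j + 1) \<le> c j + p"
        using xj x by (auto simp: b_def c_def algebra_simps)
      \<comment> \<open>Minimality of \<open>K\<close> keeps \<open>c j\<close> short of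
        \<open>N - 1\<close>, so clipping does not merge the two towers and the sum over the set
        counts both.\<close>
      have "(j + 1) * p \<le> (K - 1) * p" using jK ppos by (intro mult_right_mono) auto
      moreover have "(j + 1) * p = j * p + p" by (simp add: algebra_simps)
      ultimately have "c j - 2 * (t - r) + p < N + 2 * r - 2" using K(3) by (simp add: c_def)
      then have "c j < N - 1" using p r by simp
      then have neq: "b j \<noteq> b (j + 1)" using b_j ppos by (auto simp: b_def c_def algebra_simps)
      \<comment> \<open>The two distances sum to at most \<open>p\<close>, which is odd, so their
        halves rounded up sum to at most \<open>(p + 1) div 2 = 2 * t - r\<close>.\<close>
      have "r \<le> ?f (b j) + ?f (b (j + 1))"
        using path_signal_ge[of t "x - b j"] path_signal_ge[of t "x - b (j + 1)"] b_j b_j' xj p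
        by linarith
      also have "\<dots> = sum ?f {b j, b (j + 1)}" using neq by simp
      also have "\<dots> \<le> sum ?f (b ` {0..<K})"
        using j0 jK by (intro sum_mono2) (auto simp: path_signal_nonneg)
      finally show ?thesis .
    qed
  qed
qed

section \<open>The two-row slant grid as the square of a path\<close>

definition strip_vertex :: "nat \<Rightarrow> nat \<times> nat" where
  "strip_vertex x = (x div 2, 1 - x mod 2)"

lemma inj_strip_vertex: "inj strip_vertex"
proof (rule injI)
  fix x y assume "strip_vertex x = strip_vertex y"
  then have "x div 2 = y div 2" "1 - x mod 2 = 1 - y mod 2" by (auto simp: strip_vertex_def)
  moreover have "x mod 2 < 2" "y mod 2 < 2" by simp_all
  ultimately have "x div 2 = y div 2" "x mod 2 = y mod 2" by linarith+
  then show "x = y" by (metis mult_div_mod_eq)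
qed

lemma strip_vertex_image: "strip_vertex ` {..<2 * n} = slant_grid_verts 2 n"
proof
  show "slant_grid_verts 2 n \<subseteq> strip_vertex ` {..<2 * n}"
  proof
    fix v assume "v \<in> slant_grid_verts 2 n"
    then obtain i j where v: "v = (i, j)" "i < n" "j < 2" by (auto simp: slant_grid_verts_def)
    then have "v = strip_vertex (2 * i + (1 - j))" "2 * i + (1 - j) < 2 * n"
      by (cases "j = 0"; auto simp: strip_vertex_def)+
    then show "v \<in> strip_vertex ` {..<2 * n}" by blast
  qed
qed (auto simp: strip_vertex_def slant_grid_verts_def)

text \<open>The alternatives are the horizontal, diagonal and vertical arcs. The last two start in
  the lower row, at odd positions, and the vertical one runs backwards in zigzag order.\<close>

lemma strip_vertex_arc_iff:
  assumes "x < 2 * n" "y < 2 * n"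
  shows "(strip_vertex x, strip_vertex y) \<in> slant_grid_arcs 2 n \<longleftrightarrow>
    y = x + 2 \<or> (odd x \<and> y = x + 1) \<or> (odd x \<and> x = y + 1)"
proof -
  have "x div 2 < n" "y div 2 < n" using assms by auto
  then have "(strip_vertex x, strip_vertex y) \<in> slant_grid_arcs 2 n \<longleftrightarrow>
      (y div 2 = x div 2 + 1 \<and> 1 - y mod 2 = 1 - x mod 2) \<or>
      (y div 2 = x div 2 \<and> 1 - y mod 2 = 1 - x mod 2 + 1) \<or>
      (y div 2 = x div 2 + 1 \<and> 1 - y mod 2 = 1 - x mod 2 + 1)"
    by (auto simp: strip_vertex_def slant_grid_arcs_def slant_grid_verts_def)
  also have "\<dots> \<longleftrightarrow> y = x + 2 \<or> (odd x \<and> y = x + 1) \<or> (odd x \<and> x = y + 1)"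
  proof -
    have "x = 2 * (x div 2) + x mod 2" "x mod 2 = 0 \<or> x mod 2 = 1"
        "y = 2 * (y div 2) + y mod 2" "y mod 2 = 0 \<or> y mod 2 = 1" by auto
    then obtain i a j b where "x = 2 * i + a" "a = 0 \<or> a = 1" "y = 2 * j + b" "b = 0 \<or> b = 1"
      by metis
    then show ?thesis by (elim disjE) (auto dest: arg_cong[of _ _ even])
  qed
  finally show ?thesis .
qed

lemma sym_slant_grid_adj: "sym (slant_grid_adj m n)"
  by (auto simp: slant_grid_adj_def sym_def)

lemma strip_vertex_adj_iff:
  assumes "x < 2 * n" "y < 2 * n"
  shows "(strip_vertex x, strip_vertex y) \<in> slant_grid_adj 2 n \<longleftrightarrow>
    x \<noteq> y \<and> \<bar>int x - int y\<bar> \<le> 2"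
proof -
  have "x \<noteq> y \<and> \<bar>int x - int y\<bar> \<le> 2 \<longleftrightarrow>
      y = x + 1 \<or> y = x + 2 \<or> x = y + 1 \<or> x = y + 2" by linarith
  then show ?thesis
    unfolding slant_grid_adj_def Un_iff converse_iff
      strip_vertex_arc_iff[OF assms] strip_vertex_arc_iff[OF assms(2,1)]
    by auto
qed

lemma slant_grid_adj_verts:
  "(u, v) \<in> slant_grid_adj m n \<Longrightarrow> u \<in> slant_grid_verts m n \<and> v \<in> slant_grid_verts m n"
  by (auto simp: slant_grid_adj_def slant_grid_arcs_def)

lemma relpow_sym: "sym R \<Longrightarrow> (x, y) \<in> R ^^ k \<Longrightarrow> (y, x) \<in> R ^^ k"
proof (induction k arbitrary: y)
  case (Suc k)
  then obtain z where "(x, z) \<in> R ^^ k" "(z, y) \<in> R" by auto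
  with Suc show ?case by (blast intro: relpow_Suc_I2 symD)
qed simp

text \<open>Each edge changes the position by at most 2, and every intermediate vertex has a
  position.\<close>

lemma strip_walk_length:
  assumes "(strip_vertex x, strip_vertex y) \<in> slant_grid_adj 2 n ^^ k" "x < 2 * n" "y < 2 * n"
  shows "\<bar>int x - int y\<bar> \<le> 2 * int k"
  using assms
proof (induction k arbitrary: y)
  case 0
  then show ?case using inj_strip_vertex by (auto dest: injD)
next
  case (Suc k)
  then obtain u where u: "(strip_vertex x, u) \<in> slant_grid_adj 2 n ^^ k"
      "(u, strip_vertex y) \<in> slant_grid_adj 2 n" by auto
  then have "u \<in> strip_vertex ` {..<2 * n}"
    using slant_grid_adj_verts strip_vertex_image by blast
  then obtain z where z: "u = strip_vertex z" "z < 2 * n" by auto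
  have "\<bar>int x - int z\<bar> \<le> 2 * int k" using Suc u z by blast
  moreover have "\<bar>int z - int y\<bar> \<le> 2" using strip_vertex_adj_iff[of z n y] u z Suc.prems by blast
  ultimately show ?case by simp
qed

text \<open>Steps of 2, with a single step of 1 when \<open>m\<close> is odd.\<close>

lemma strip_walk_exists:
  assumes "x + m < 2 * n"
  shows "(strip_vertex x, strip_vertex (x + m)) \<in> slant_grid_adj 2 n ^^ ((m + 1) div 2)"
  using assms
proof (induction m rule: less_induct)
  case (less m)
  consider "m = 0" | "m = 1" | l where "m = l + 2" by (metis One_nat_def add_2_eq_Suc' not0_implies_Suc)
  then show ?case
  proof cases
    case 2
    then show ?thesis using less.prems strip_vertex_adj_iff[of x n "x + 1"] by simp
  next
    case 3
    have "(strip_vertex x, strip_vertex (x + l)) \<in> slant_grid_adj 2 n ^^ ((l + 1) div 2)"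
      using less 3 by simp
    moreover have "(strip_vertex (x + l), strip_vertex (x + m)) \<in> slant_grid_adj 2 n"
      using less.prems 3 strip_vertex_adj_iff[of "x + l" n "x + m"] by simp
    ultimately show ?thesis using 3 by auto
  qed simp
qed

lemma strip_dist:
  assumes "x < 2 * n" "y < 2 * n"
  shows "int (graph_dist (slant_grid_adj 2 n) (strip_vertex x) (strip_vertex y)) =
    (\<bar>int x - int y\<bar> + 1) div 2"
proof -
  define k where "k = nat ((\<bar>int x - int y\<bar> + 1) div 2)"
  have "(strip_vertex x, strip_vertex y) \<in> slant_grid_adj 2 n ^^ k"
  proof (cases "x \<le> y")
    case True
    then have "k = (y - x + 1) div 2" by (simp add: k_def)
    then show ?thesis using strip_walk_exists[of x "y - x" n] True assms by simp
  next
    case False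
    then have "k = (x - y + 1) div 2" by (simp add: k_def)
    then show ?thesis
      using strip_walk_exists[of y "x - y" n] False assms relpow_sym[OF sym_slant_grid_adj] by simp
  qed
  moreover have "k \<le> l" if "(strip_vertex x, strip_vertex y) \<in> slant_grid_adj 2 n ^^ l" for l
    using strip_walk_length[OF that assms] by (simp add: k_def)
  ultimately have "graph_dist (slant_grid_adj 2 n) (strip_vertex x) (strip_vertex y) = k"
    unfolding graph_dist_def by (rule Least_equality)
  then show ?thesis by (simp add: k_def)
qed

lemma strip_signal:
  assumes "x < 2 * n" "Y \<subseteq> {..<2 * n}"
  shows "signal (slant_grid_adj 2 n) t (strip_vertex ` Y) (strip_vertex x) =
    (\<Sum>y\<in>int ` Y. path_signal (int t) (int x - y))"
proof -
  have "signal (slant_grid_adj 2 n) t (strip_vertex ` Y) (strip_vertex x) =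
      (\<Sum>y\<in>Y. max 0 (int t - int (graph_dist (slant_grid_adj 2 n) (strip_vertex x) (strip_vertex y))))"
    unfolding signal_def by (subst sum.reindex) (auto intro: inj_on_subset[OF inj_strip_vertex])
  also have "\<dots> = (\<Sum>y\<in>Y. path_signal (int t) (int x - int y))"
    using assms by (intro sum.cong) (auto simp: path_signal_def strip_dist subset_eq)
  also have "\<dots> = (\<Sum>y\<in>int ` Y. path_signal (int t) (int x - y))"
    by (subst sum.reindex) (auto simp: inj_on_def)
  finally show ?thesis .
qed

lemma broadcast_dominating_strip_iff:
  assumes "Y \<subseteq> {..<2 * n}"
  shows "broadcast_dominating (slant_grid_verts 2 n) (slant_grid_adj 2 n) t r (strip_vertex ` Y) \<longleftrightarrow>
    (\<forall>x<2 * n. int r \<le> (\<Sum>y\<in>int ` Y. path_signal (int t) (int x - y)))"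
proof -
  have "strip_vertex ` Y \<subseteq> slant_grid_verts 2 n"
    using assms strip_vertex_image by blast
  then show ?thesis
    unfolding broadcast_dominating_def strip_vertex_image[symmetric]
    using assms by (auto simp: strip_signal)
qed

theorem theorem1p4:
  fixes n t r :: nat
  assumes "n \<ge> 1" and "r \<ge> 1" and "t > r"
  shows "int (broadcast_domination_number (slant_grid_verts 2 n) (slant_grid_adj 2 n) t r) =
    \<lceil>2 * (real n + real r - 1) / (4 * real t - 2 * real r - 1)\<rceil>"
proof -
  define p where "p = 4 * int t - 2 * int r - 1"
  define M where "M = 2 * int n + 2 * int r - 2"
  define K where "K = \<lceil>real_of_int M / real_of_int p\<rceil>"
  define g where "g = broadcast_domination_number (slant_grid_verts 2 n) (slant_grid_adj 2 n) t r"
  let ?dom = "broadcast_dominating (slant_grid_verts 2 n) (slant_grid_adj 2 n) t r"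
  have p: "0 < p" and M: "0 < M" using assms by (auto simp: p_def M_def)
  \<comment> \<open>Taken at a cardinality this gives the lower bound; at \<open>K\<close> and
    \<open>K - 1\<close> it gives the hypotheses of the construction.\<close>
  have K_le_iff: "K \<le> k \<longleftrightarrow> M \<le> k * p" for k
  proof -
    have "K \<le> k \<longleftrightarrow> real_of_int M \<le> real_of_int (k * p)"
      using p by (simp add: K_def ceiling_le_iff pos_divide_le_eq)
    then show ?thesis by (simp only: of_int_le_iff)
  qed
  have K_pos: "1 \<le> K" using K_le_iff[of 0] M by simp
  have K_le_card: "K \<le> int (card T)" if T: "?dom T" for T
  proof -
    have "T \<subseteq> strip_vertex ` {..<2 * n}"
      using T by (simp add: broadcast_dominating_def strip_vertex_image)
    then obtain Y where Y: "Y \<subseteq> {..<2 * n}" "T = strip_vertex ` Y" by (auto simp: subset_image_iff)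
    have "2 * int n + 2 * int r - 2 \<le> int (card (int ` Y)) * (4 * int t - 2 * int r - 1)"
    proof (rule dominating_path_square_card)
      fix x assume "0 \<le> x" "x < 2 * int n"
      then show "int r \<le> (\<Sum>y\<in>int ` Y. path_signal (int t) (x - y))"
        using T broadcast_dominating_strip_iff[OF Y(1)] Y(2)
        by (cases x rule: nonneg_int_cases) auto
    qed (use assms Y in auto)
    moreover have "card (int ` Y) = card Y" "card T = card Y"
      using inj_strip_vertex Y by (auto intro!: card_image inj_on_subset[OF inj_strip_vertex])
    ultimately show ?thesis using K_le_iff by (simp add: M_def p_def)
  qed
  obtain Z where Z: "Z \<subseteq> {0..<2 * int n}" "int (card Z) \<le> K"
    "\<And>x. 0 \<le> x \<Longrightarrow> x < 2 * int n \<Longrightarrow> int r \<le> (\<Sum>y\<in>Z. path_signal (int t) (x - y))"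
    using dominating_path_square_exists[of "int r" "int t" "2 * int n" p K]
      K_pos K_le_iff[of K] K_le_iff[of "K - 1"] assms p_def M_def by auto
  define T where "T = strip_vertex ` nat ` Z"
  \<comment> \<open>Positions in \<open>Z\<close> are nonnegative, so \<open>nat\<close> loses
    nothing.\<close>
  have "int ` nat ` Z = Z" using Z(1) by (force simp: image_image)
  then have T: "?dom T"
    unfolding T_def using Z by (subst broadcast_dominating_strip_iff) (auto dest!: subsetD)
  have "card T \<le> card Z"
  proof -
    have "finite Z" using Z(1) finite_subset by blast
    then show ?thesis unfolding T_def by (metis card_image_le finite_imageI le_trans)
  qed
  then have "int (card T) \<le> K" using Z(2) by simp
  moreover have "g \<le> card T"
    unfolding g_def broadcast_domination_number_def using T by (intro Least_le) blast
  \<comment> \<open>The set \<open>T\<close> witnesses that the minimum is attained, so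
    \<open>K_le_card\<close> applies to a minimizer.\<close>
  moreover have "\<exists>T'. ?dom T' \<and> card T' = g"
    unfolding g_def broadcast_domination_number_def
    using T by (intro LeastI[of "\<lambda>k. \<exists>T'. ?dom T' \<and> card T' = k" "card T"]) blast
  ultimately have "int g = K" using K_le_card by force
  then show ?thesis by (simp add: g_def K_def M_def p_def algebra_simps)
qed

end
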